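(* Let $n\ge 1$ and let $X_1,\dots,X_n$ be independent integer-valued random variables. Then $$\Delta_\infty(X_1+\cdots+X_n)\ \geq\ \frac{1}{20}\sum_{i=1}^n\Delta_\infty(X_i).$$
   Context: For an integer-valued random variable $X$ with $f_X(k)=\mathbb{P}(X=k)$, let $\|f_X\|_\infty=\sup_{k\in\mathbb{Z}}f_X(k)$, $H_\infty(X)=-\log\|f_X\|_\infty$ (natural logarithm), and $\Delta_\infty(X)=e^{2H_\infty(X)}-1=\|f_X\|_\infty^{-2}-1$. *)

theory Defs
  imports "HOL-Probability.Probability"
begin

definition mass_fun :: "'a measure \<Rightarrow> ('a \<Rightarrow> int) \<Rightarrow> int \<Rightarrow> real" where
  "mass_fun M X k = \<P>(\<omega> in M. X \<omega> = k)"

text \<open>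
  The supremum below is a conditionally complete one on the reals; it is
  well-behaved because \<^term>\<open>mass_fun M X\<close> takes values in [0, 1] on a probability
  space. It is moreover positive for a random variable \<^term>\<open>X\<close>, so the logarithm
  in the min-entropy is never taken at the junk argument 0.
\<close>

definition mass_sup :: "'a measure \<Rightarrow> ('a \<Rightarrow> int) \<Rightarrow> real" where
  "mass_sup M X = (SUP k. mass_fun M X k)"

definition min_entropy :: "'a measure \<Rightarrow> ('a \<Rightarrow> int) \<Rightarrow> real" where
  "min_entropy M X = - ln (mass_sup M X)"

definition Delta_inf :: "'a measure \<Rightarrow> ('a \<Rightarrow> int) \<Rightarrow> real" where
  "Delta_inf M X = exp (2 * min_entropy M X) - 1"

end

theory Submission
  imports Defs
begin

text \<open>
  Measure the spread of an integer random variable by the maximal probability of a set of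
  \<open>t\<close> points, as a function of \<open>t\<close>. If \<open>X\<close> has mass at most \<open>m \<le> 1/2\<close>, put \<open>k = \<lfloor>1/m\<rfloor>\<close>: in every
  estimate linear in its distribution, \<open>X\<close> is no worse than a uniform variable on some \<open>k\<close> points;
  if \<open>m > 1/2\<close> it is no worse than a mixture of a constant and a uniform variable on two points.
  Splitting \<open>A \<times> B\<close> into hooks on which \<open>a - b\<close> is injective shows that, among all uniform variables
  on \<open>k\<close> points, the convolution with an interval of length \<open>k\<close> is the most concentrated.
  Hence the maximal mass of the sum is bounded by a mixture of maximal masses \<open>Q\<close> of sums of
  independent uniform variables on centred intervals of lengths \<open>k\<^sub>1, k\<^sub>2, \<dots>\<close>. Such a sum is symmetric
  and log-concave, which forces \<open>1/Q\<^sup>2 \<ge> 1 + 2 V\<close> for its variance \<open>V\<close>, that is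
  \<open>1/Q\<^sup>2 \<ge> 1 + \<Sum>(k\<^sub>i\<^sup>2 - 1)/6\<close>. The passage from \<open>1/m\<close> to its integer part, and the averaging over the
  mixtures, cost no more than the remaining factor.
\<close>

section \<open>Sums of independent uniform steps\<close>

text \<open>
  The expectation of \<open>\<phi>\<close> at the end of a walk with independent steps, the step belonging to \<open>k\<close>
  being uniform on \<open>-(k-1), -(k-3), \<dots>, k-1\<close>. Doubling the lattice keeps even \<open>k\<close> integral.
\<close>

fun walk_expect :: "nat list \<Rightarrow> (int \<Rightarrow> real) \<Rightarrow> real" where
  "walk_expect [] \<phi> = \<phi> 0"
| "walk_expect (k # ks) \<phi> =
     (\<Sum>j<k. walk_expect ks (\<lambda>x. \<phi> (x + (int k - 1 - 2 * int j)))) / real k"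

definition walk_width :: "nat list \<Rightarrow> int" where
  "walk_width ks = (\<Sum>k\<leftarrow>ks. int k - 1)"

definition walk_mass :: "nat list \<Rightarrow> int \<Rightarrow> real" where
  "walk_mass ks y = walk_expect ks (\<lambda>x. of_bool (x = y))"

lemma sum_reflect_steps:
  "(\<Sum>j<k. g (- (int k - 1 - 2 * int j))) = (\<Sum>j<k. g (int k - 1 - 2 * int j) :: real)"
  by (subst sum.nat_diff_reindex [symmetric]) (auto intro!: sum.cong arg_cong[where f = g])

lemma walk_expect_add:
  "walk_expect ks (\<lambda>x. \<phi> x + \<psi> x) = walk_expect ks \<phi> + walk_expect ks \<psi>"
  by (induction ks arbitrary: \<phi> \<psi>) (simp_all add: sum.distrib add_divide_distrib)

lemma walk_expect_cmult: "walk_expect ks (\<lambda>x. c * \<phi> x) = c * walk_expect ks \<phi>"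
  by (induction ks arbitrary: \<phi>) (simp_all add: sum_distrib_left)

lemma walk_expect_sum:
  "walk_expect ks (\<lambda>x. \<Sum>y\<in>S. F y x) = (\<Sum>y\<in>S. walk_expect ks (F y))"
proof (cases "finite S")
  case True
  then show ?thesis
    by (induction S)
      (use walk_expect_cmult [of ks 0 "\<lambda>_. 0"] in \<open>simp_all add: walk_expect_add\<close>)
qed (use walk_expect_cmult [of ks 0 "\<lambda>_. 0"] in simp)

lemma walk_expect_const:
  assumes "\<forall>k\<in>set ks. 0 < k"
  shows "walk_expect ks (\<lambda>_. c) = c"
  using assms by (induction ks) auto

lemma walk_expect_reflect: "walk_expect ks (\<lambda>x. \<phi> (- x)) = walk_expect ks \<phi>"
proof (induction ks arbitrary: \<phi>)
  case (Cons k ks)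
  have "walk_expect ks (\<lambda>x. \<phi> (- (x + c))) = walk_expect ks (\<lambda>x. \<phi> (x + (- c)))" for c
    using Cons.IH [of "\<lambda>x. \<phi> (x + (- c))"] by (simp add: algebra_simps)
  then show ?case
    unfolding walk_expect.simps
    by (simp only: sum_reflect_steps [of "\<lambda>c. walk_expect ks (\<lambda>x. \<phi> (x + c))" k])
qed simp

text \<open>The walk ends within \<open>walk_width ks\<close> of the origin, in the residue class of
  \<open>walk_width ks\<close> modulo 2. Other values of the function never enter.\<close>

lemma walk_expect_cong:
  assumes "\<forall>k\<in>set ks. 0 < k"
    and "\<And>x. \<bar>x\<bar> \<le> walk_width ks \<Longrightarrow> even (x - walk_width ks) \<Longrightarrow> \<phi> x = \<psi> x"
  shows "walk_expect ks \<phi> = walk_expect ks \<psi>"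
  using assms
proof (induction ks arbitrary: \<phi> \<psi>)
  case (Cons k ks)
  have "walk_expect ks (\<lambda>x. \<phi> (x + (int k - 1 - 2 * int j))) =
      walk_expect ks (\<lambda>x. \<psi> (x + (int k - 1 - 2 * int j)))" if "j < k" for j
    using Cons.prems(1) that
    by (intro Cons.IH Cons.prems(2)) (auto simp: walk_width_def)
  then show ?case by simp
qed (simp add: walk_width_def)

lemma walk_mass_nonneg: "0 \<le> walk_mass ks y"
proof -
  have "0 \<le> walk_expect ks \<phi>" if "\<And>x. 0 \<le> \<phi> x" for \<phi>
    using that by (induction ks arbitrary: \<phi>) (auto intro!: sum_nonneg divide_nonneg_nonneg)
  then show ?thesis by (simp add: walk_mass_def)
qed

lemma walk_mass_eq_0:
  assumes "\<forall>k\<in>set ks. 0 < k" and "walk_width ks < \<bar>y\<bar> \<or> odd (y - walk_width ks)"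
  shows "walk_mass ks y = 0"
proof -
  have "walk_mass ks y = walk_expect ks (\<lambda>_. 0)"
    unfolding walk_mass_def using assms by (intro walk_expect_cong) auto
  then show ?thesis using assms walk_expect_const by simp
qed

lemma walk_expect_eq_sum:
  assumes "\<forall>k\<in>set ks. 0 < k" and "finite S" and "{- walk_width ks..walk_width ks} \<subseteq> S"
  shows "walk_expect ks \<phi> = (\<Sum>y\<in>S. walk_mass ks y * \<phi> y)"
proof -
  have "walk_expect ks \<phi> = walk_expect ks (\<lambda>x. \<Sum>y\<in>S. \<phi> y * of_bool (x = y))"
  proof (rule walk_expect_cong [OF assms(1)])
    fix x assume "\<bar>x\<bar> \<le> walk_width ks"
    then have "x \<in> S" by (intro subsetD [OF assms(3)]) auto
    then show "\<phi> x = (\<Sum>y\<in>S. \<phi> y * of_bool (x = y))"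
      using assms(2) by (simp add: of_bool_def if_distrib cong: if_cong)
  qed
  then show ?thesis
    by (simp add: walk_expect_sum walk_expect_cmult walk_mass_def mult.commute)
qed

lemma walk_mass_uminus: "walk_mass ks (- y) = walk_mass ks y"
proof -
  have "(\<lambda>x. of_bool (- x = y) :: real) = (\<lambda>x. of_bool (x = - y))"
    by (auto simp: fun_eq_iff)
  then show ?thesis
    using walk_expect_reflect [of ks "\<lambda>x. of_bool (x = y)"] by (simp add: walk_mass_def)
qed

lemma walk_mass_Cons:
  "walk_mass (k # ks) y = (\<Sum>j<k. walk_mass ks (y + (int k - 1 - 2 * int j))) / real k"
proof -
  have "walk_mass (k # ks) y = (\<Sum>j<k. walk_mass ks (y + (- (int k - 1 - 2 * int j)))) / real k"
    unfolding walk_mass_def walk_expect.simps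
    by (intro arg_cong2[where f = "(/)"] sum.cong refl arg_cong2[where f = walk_expect] ext) auto
  then show ?thesis
    by (simp only: sum_reflect_steps [of "\<lambda>c. walk_mass ks (y + c)" k])
qed

section \<open>Variance of the walk\<close>

lemma sum_centred_squares:
  "(\<Sum>j<k. (real k - 1 - 2 * real j)\<^sup>2) = real k * (real k ^ 2 - 1) / 3"
proof -
  have *: "(\<Sum>j<k. real j) = real k * (real k - 1) / 2" "(\<Sum>j<k. real j ^ 2) = real k * (real k - 1) * (2 * real k - 1) / 6"
    by (induction k) (simp_all add: field_simps power2_eq_square)
  have "(\<Sum>j<k. (real k - 1 - 2 * real j)\<^sup>2) =
      (\<Sum>j<k. (real k - 1)\<^sup>2 - 4 * (real k - 1) * real j + 4 * real j ^ 2)"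
    by (intro sum.cong) (auto simp: power2_eq_square algebra_simps)
  also have "\<dots> = real k * (real k - 1)\<^sup>2 - 4 * (real k - 1) * (\<Sum>j<k. real j) + 4 * (\<Sum>j<k. real j ^ 2)"
    by (simp add: sum.distrib sum_subtractf sum_distrib_left)
  also have "\<dots> = real k * (real k ^ 2 - 1) / 3"
    unfolding * by (simp add: field_simps power2_eq_square)
  finally show ?thesis .
qed

text \<open>The steps are independent and centred, so variances add. On the doubled lattice a
  uniform step on \<open>k\<close> points has variance \<open>(k^2 - 1) / 3\<close>, four times the
  usual \<open>(k^2 - 1) / 12\<close>.\<close>

lemma walk_variance:
  assumes "\<forall>k\<in>set ks. 0 < k"
  shows "walk_expect ks (\<lambda>x. (real_of_int x)\<^sup>2) = (\<Sum>k\<leftarrow>ks. (real k ^ 2 - 1) / 3)"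
  using assms
proof (induction ks)
  case (Cons k ks)
  \<comment> \<open>The mean vanishes by reflection, which removes the cross term of the
    square.\<close>
  have m1: "walk_expect ks real_of_int = 0"
    using walk_expect_reflect [of ks real_of_int] walk_expect_cmult [of ks "-1" real_of_int] by simp
  have "walk_expect ks (\<lambda>x. (real_of_int (x + c))\<^sup>2) =
      walk_expect ks (\<lambda>x. (real_of_int x)\<^sup>2) + (real_of_int c)\<^sup>2" for c
  proof -
    have "walk_expect ks (\<lambda>x. (real_of_int (x + c))\<^sup>2) =
      walk_expect ks (\<lambda>x. ((real_of_int x)\<^sup>2 + (2 * real_of_int c) * real_of_int x) + (real_of_int c)\<^sup>2)"
      by (intro arg_cong2[where f = walk_expect] refl ext) (simp add: power2_eq_square algebra_simps)
    then show ?thesis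
      using Cons.prems m1 by (simp only: walk_expect_add walk_expect_cmult) (simp add: walk_expect_const)
  qed
  then have "walk_expect (k # ks) (\<lambda>x. (real_of_int x)\<^sup>2) =
      (\<Sum>j<k. walk_expect ks (\<lambda>x. (real_of_int x)\<^sup>2) +
        (real_of_int (int k - 1 - 2 * int j))\<^sup>2) / real k"
    by (simp only: walk_expect.simps)
  also have "\<dots> =
      (\<Sum>j<k. walk_expect ks (\<lambda>x. (real_of_int x)\<^sup>2) + (real k - 1 - 2 * real j)\<^sup>2) / real k"
    by simp
  also have "\<dots> = walk_expect ks (\<lambda>x. (real_of_int x)\<^sup>2) + (real k ^ 2 - 1) / 3"
    unfolding sum.distrib sum_centred_squares using Cons.prems by (simp add: field_simps)
  finally show ?case using Cons by simp
qed simp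

text \<open>
  Log-concavity along steps of size 2, because the walk lives on one residue class modulo 2.
\<close>

definition even_log_concave :: "(int \<Rightarrow> real) \<Rightarrow> bool" where
  "even_log_concave f \<longleftrightarrow>
     (\<forall>u v u' v'. u' \<le> u \<longrightarrow> u' \<le> v \<longrightarrow> u + v = u' + v' \<longrightarrow> even (u - u') \<longrightarrow> even (v - u') \<longrightarrow>
        f u' * f v' \<le> f u * f v)"

lemma even_log_concaveD:
  assumes "even_log_concave f" "u' \<le> u" "u' \<le> v" "u + v = u' + v'" "even (u - u')" "even (v - u')"
  shows "f u' * f v' \<le> f u * f v"
  using assms unfolding even_log_concave_def by blast

text \<open>Any wider pair arises from the inner pair by repeatedly moving both points outwards by
  2, so a single such move suffices.\<close>

lemma even_log_concaveI:
  assumes step: "\<And>x y. x \<le> y \<Longrightarrow> even (y - x) \<Longrightarrow> h (x - 2) * h (y + 2) \<le> h x * h y"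
  shows "even_log_concave h"
proof -
  have iter: "h (x - 2 * int d) * h (y + 2 * int d) \<le> h x * h y" if "x \<le> y" "even (y - x)" for x y d
  proof (induction d)
    case (Suc d)
    have "h (x - 2 * int d - 2) * h (y + 2 * int d + 2) \<le> h (x - 2 * int d) * h (y + 2 * int d)"
      using that by (intro step) auto
    then show ?case using Suc by (simp add: algebra_simps)
  qed simp
  have main: "h u' * h v' \<le> h u * h v"
    if "u' \<le> u" "u \<le> v" "u + v = u' + v'" "even (u - u')" "even (v - u')" for u v u' v'
  proof -
    obtain e where e: "u - u' = 2 * e" using \<open>even (u - u')\<close> by (elim dvdE)
    have "u' = u - 2 * int (nat e)" "v' = v + 2 * int (nat e)"
      using that e by auto
    moreover have "even (v - u)" using that by presburger
    ultimately
    show ?thesis using iter [of u v "nat e"] that by simp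
  qed
  show ?thesis
    unfolding even_log_concave_def
  proof (intro allI impI)
    fix u v u' v' :: int
    assume *: "u' \<le> u" "u' \<le> v" "u + v = u' + v'" "even (u - u')" "even (v - u')"
    then show "h u' * h v' \<le> h u * h v"
      using main [of u' u v v'] main [of u' v u v'] by (cases "u \<le> v") (auto simp: mult.commute)
  qed
qed

text \<open>Moving the box by 2 gains one value of \<open>f\<close> and loses another. Expanding the
  two products around \<open>?h (x - 2) * ?h y\<close> leaves only products of one value of
  \<open>f\<close> with one box sum, and these compare term by term by log-concavity of
  \<open>f\<close>.\<close>

lemma even_log_concave_box_convolution:
  fixes f :: "int \<Rightarrow> real"
  assumes "even_log_concave f"
  shows "even_log_concave (\<lambda>x. \<Sum>j<k. f (x + (int k - 1 - 2 * int j)))"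
    (is "even_log_concave ?h")
proof (rule even_log_concaveI)
  fix x y :: int assume xy: "x \<le> y" "even (y - x)"
  have shift: "?h (z + 2) = ?h z + f (z + int k + 1) - f (z - int k + 1)" for z
  proof -
    define g where "g j = f (z + int k + 1 - 2 * int j)" for j
    have "?h (z + 2) + g k = (\<Sum>j<Suc k. g j)"
      unfolding g_def by (simp add: algebra_simps)
    also have "\<dots> = g 0 + ?h z"
      unfolding sum.lessThan_Suc_shift g_def by (simp add: algebra_simps)
    finally show ?thesis by (simp add: g_def algebra_simps)
  qed
  have A: "?h (x - 2) * f (y + int k + 1) \<le> f (x + int k - 1) * ?h y"
    unfolding sum_distrib_left sum_distrib_right
    using xy by (intro sum_mono even_log_concaveD [OF assms]) auto
  have B: "f (x - int k - 1) * ?h y \<le> ?h (x - 2) * f (y - int k + 1)"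
    unfolding sum_distrib_left sum_distrib_right
    using xy by (intro sum_mono even_log_concaveD [OF assms]) auto
  have eq: "?h x = ?h (x - 2) + f (x + int k - 1) - f (x - int k - 1)"
    using shift [of "x - 2"] by (simp add: algebra_simps)
  have "X * (Y + a - b) \<le> (X + c - d) * Y"
    if "X * a \<le> c * Y" "d * Y \<le> X * b" for X Y a b c d :: real
    using that by (simp add: algebra_simps)
  from this [OF A B] show "?h (x - 2) * ?h (y + 2) \<le> ?h x * ?h y"
    by (simp only: shift [of y] eq)
qed

lemma walk_mass_log_concave: "even_log_concave (walk_mass ks)"
proof (induction ks)
  case Nil
  have "walk_mass [] = (\<lambda>y. of_bool (y = 0))" by (auto simp: walk_mass_def fun_eq_iff)
  then show ?case by (auto simp: even_log_concave_def)
next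
  case (Cons k ks)
  have "even_log_concave (\<lambda>x. c * f x)" if "even_log_concave f" "0 \<le> c" for c f
    using that unfolding even_log_concave_def
    by (metis (no_types, opaque_lifting) mult.assoc mult.left_commute mult_left_mono)
  from this [OF even_log_concave_box_convolution [OF Cons], of "1 / real k"] show ?case
    by (simp add: walk_mass_Cons [abs_def])
qed

section \<open>Mode and variance of a log-concave walk\<close>

text \<open>Sum \<open>p 0 * p (i + j) \<le> p i * p j\<close> over all \<open>i\<close>,
  \<open>j\<close> with weight \<open>c i\<close>, and collect the left side by
  \<open>s = i + j\<close>: the coefficient of \<open>p s\<close> becomes
  \<open>\<Sum>i\<le>s. c i\<close>. The choice \<open>c i = 1\<close> gives \<open>s + 1\<close>
  and the first bound, \<open>c i = i\<close> gives \<open>s * (s + 1) / 2\<close> and the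
  second.\<close>

lemma log_concave_tail_moments:
  fixes p :: "nat \<Rightarrow> real"
  assumes lc: "\<And>i j. p 0 * p (i + j) \<le> p i * p j" and p0: "\<And>i. L < i \<Longrightarrow> p i = 0"
  defines "m \<equiv> \<lambda>r. \<Sum>i\<le>L. real i ^ r * p i"
  shows "p 0 * (m 0 + m 1) \<le> m 0 * m 0" and "p 0 * (m 1 + m 2) \<le> 2 * m 0 * m 1"
proof -
  have diag: "(\<Sum>i\<le>L. \<Sum>j\<le>L. c i * p (i + j)) = (\<Sum>s\<le>L. (\<Sum>i\<le>s. c i) * p s)" for c :: "nat \<Rightarrow> real"
  proof -
    have "(\<Sum>j\<le>L. c i * p (i + j)) = (\<Sum>s\<le>L. if i \<le> s then c i * p s else 0)" if "i \<le> L" for i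
    proof -
      have "(\<Sum>j\<le>L. c i * p (i + j)) = (\<Sum>s\<in>{i..i + L}. c i * p s)"
        by (rule sum.reindex_bij_witness [of _ "\<lambda>s. s - i" "\<lambda>j. i + j"]) auto
      also have "\<dots> = (\<Sum>s\<in>{i..L}. c i * p s)"
        using p0 by (intro sum.mono_neutral_right) auto
      also have "\<dots> = (\<Sum>s\<le>L. if i \<le> s then c i * p s else 0)"
        by (rule sum.mono_neutral_cong_left) auto
      finally show ?thesis .
    qed
    then have "(\<Sum>i\<le>L. \<Sum>j\<le>L. c i * p (i + j)) = (\<Sum>s\<le>L. \<Sum>i\<le>L. if i \<le> s then c i * p s else 0)"
      by (subst sum.swap) simp
    also have "\<dots> = (\<Sum>s\<le>L. \<Sum>i\<le>s. c i * p s)"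
      by (intro sum.cong refl sum.mono_neutral_cong_right) auto
    finally show ?thesis by (simp add: sum_distrib_right)
  qed
  have le: "p 0 * (\<Sum>s\<le>L. (\<Sum>i\<le>s. c i) * p s) \<le> (\<Sum>i\<le>L. c i * p i) * m 0"
    if "\<And>i. 0 \<le> c i" for c :: "nat \<Rightarrow> real"
  proof -
    have "p 0 * (\<Sum>i\<le>L. \<Sum>j\<le>L. c i * p (i + j)) \<le> (\<Sum>i\<le>L. \<Sum>j\<le>L. (c i * p i) * p j)"
      unfolding sum_distrib_left
      using mult_left_mono [OF lc that] by (intro sum_mono) (simp add: mult_ac)
    then show ?thesis unfolding diag by (simp add: m_def sum_product)
  qed
  have "(\<Sum>s\<le>L. (\<Sum>i\<le>s. 1) * p s) = m 0 + m 1"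
    by (simp add: m_def sum.distrib algebra_simps)
  then show "p 0 * (m 0 + m 1) \<le> m 0 * m 0"
    using le [of "\<lambda>_. 1"] by (simp add: m_def)
  have "(\<Sum>i\<le>s. real i) = (real s + real s ^ 2) / 2" for s
    by (induction s) (simp_all add: field_simps power2_eq_square)
  then have "(\<Sum>i\<le>s. real i) * p s = (real s * p s + real s ^ 2 * p s) / 2" for s
    by (simp add: algebra_simps)
  moreover have "(m 1 + m 2) / 2 = (\<Sum>s\<le>L. (real s * p s + real s ^ 2 * p s) / 2)"
    by (simp add: m_def sum.distrib flip: sum_divide_distrib)
  ultimately have "(\<Sum>s\<le>L. (\<Sum>i\<le>s. real i) * p s) = (m 1 + m 2) / 2"
    by (simp only:)
  moreover have "(\<Sum>i\<le>L. real i * p i) = m 1" by (simp add: m_def)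
  ultimately have "p 0 * ((m 1 + m 2) / 2) \<le> m 1 * m 0"
    using le [of real] by (simp only:)
  then show "p 0 * (m 1 + m 2) \<le> 2 * m 0 * m 1"
    by (simp add: mult_ac)
qed

text \<open>Opposite points are paired. The pair for \<open>i = 0\<close> counts the origin twice,
  hence the correction.\<close>

lemma sum_even_support:
  fixes \<psi> :: "int \<Rightarrow> real"
  assumes "\<And>x. odd x \<Longrightarrow> \<psi> x = 0"
  shows "(\<Sum>x = - (2 * int L)..2 * int L. \<psi> x) =
    (\<Sum>i\<le>L. \<psi> (2 * int i) + \<psi> (- (2 * int i))) - \<psi> 0"
proof (induction L)
  case (Suc L)
  have "{- (2 * int (Suc L))..2 * int (Suc L)} =
      {- (2 * int L)..2 * int L} \<union>
      {2 * int L + 1, 2 * int L + 2, - 1 - 2 * int L, - 2 - 2 * int L}"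
    by auto
  then have "(\<Sum>x = - (2 * int (Suc L))..2 * int (Suc L). \<psi> x) =
      (\<Sum>x = - (2 * int L)..2 * int L. \<psi> x) + (\<psi> (2 * int L + 2) + \<psi> (- 2 - 2 * int L))"
    using assms by (simp add: sum.union_disjoint)
  then show ?case using Suc by (simp add: algebra_simps)
qed simp

lemma sum_odd_support:
  fixes \<psi> :: "int \<Rightarrow> real"
  assumes "\<And>x. even x \<Longrightarrow> \<psi> x = 0"
  shows "(\<Sum>x = - (2 * int L + 1)..2 * int L + 1. \<psi> x) =
    (\<Sum>i\<le>L. \<psi> (2 * int i + 1) + \<psi> (- (2 * int i + 1)))"
proof (induction L)
  case 0
  have "{- 1..1 :: int} = {-1, 0, 1}" by auto
  then show ?case using assms [of 0] by simp
next
  case (Suc L)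
  have "{- (2 * int (Suc L) + 1)..2 * int (Suc L) + 1} =
      {- (2 * int L + 1)..2 * int L + 1} \<union>
      {2 * int L + 2, 2 * int L + 3, - 2 - 2 * int L, - 3 - 2 * int L}"
    by auto
  then have "(\<Sum>x = - (2 * int (Suc L) + 1)..2 * int (Suc L) + 1. \<psi> x) =
      (\<Sum>x = - (2 * int L + 1)..2 * int L + 1. \<psi> x) + (\<psi> (2 * int L + 3) + \<psi> (- 3 - 2 * int L))"
    using assms by (simp add: sum.union_disjoint)
  then show ?case using Suc by (simp add: algebra_simps)
qed

text \<open>By parity at most one of the two masses in \<open>M\<close> is nonzero, so
  \<open>M\<close> is the mass of the class at its central point (or at each of its two central
  points). The two moment inequalities, applied to the nonnegative half of the walk, bound
  \<open>m 2\<close> in terms of \<open>M\<close> once \<open>m 1\<close> is eliminated and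
  \<open>m 0\<close> is known from the total mass 1.\<close>

lemma walk_mode_bound:
  assumes pos: "\<forall>k\<in>set ks. 0 < k"
  defines "M \<equiv> walk_mass ks 0 + walk_mass ks 1"
  shows "M\<^sup>2 * (1 + (\<Sum>k\<leftarrow>ks. (real k ^ 2 - 1) / 6)) \<le> 1"
proof -
  define w where "w = walk_mass ks"
  define L where "L = nat (walk_width ks)"
  define V where "V = walk_expect ks (\<lambda>x. (real_of_int x)\<^sup>2)"
  have V: "(\<Sum>k\<leftarrow>ks. (real k ^ 2 - 1) / 6) = V / 2"
    unfolding V_def walk_variance [OF pos] by (induction ks) (auto simp: add_divide_distrib)
  have lc: "even_log_concave w" unfolding w_def by (rule walk_mass_log_concave)
  have w_neg: "w (- y) = w y" for y by (simp add: w_def walk_mass_uminus)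
  have w0: "w y = 0" if "int L < \<bar>y\<bar> \<or> odd (y - walk_width ks)" for y
    unfolding w_def using that by (intro walk_mass_eq_0 pos) (auto simp: L_def split: if_splits)
  have w_nonneg: "0 \<le> w y" for y by (simp add: w_def walk_mass_nonneg)
  have expect: "walk_expect ks \<phi> = (\<Sum>y = - c..c. w y * \<phi> y)" if "int L \<le> c" for \<phi> c
    unfolding w_def using that by (intro walk_expect_eq_sum pos) (auto simp: L_def)
  note one = walk_expect_const [OF pos, of 1]
  show ?thesis
  proof (cases "even (walk_width ks)")
    case True
    define p where "p i = w (2 * int i)" for i
    define m where "m r = (\<Sum>i\<le>L. real i ^ r * p i)" for r
    have odd0: "w x = 0" if "odd x" for x using w0 that True by simp
    have M: "M = p 0" using odd0 [of 1] by (simp add: M_def p_def flip: w_def)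
    have moments: "p 0 * (m 0 + m 1) \<le> m 0 * m 0" "p 0 * (m 1 + m 2) \<le> 2 * m 0 * m 1"
      unfolding m_def
      by (rule log_concave_tail_moments;
          force simp: p_def intro!: even_log_concaveD [OF lc] w0)+
    \<comment> \<open>The origin belongs to both halves, so its mass \<open>M\<close> is subtracted
      once.\<close>
    have "1 = 2 * m 0 - M"
      using one unfolding M
      by (subst (asm) expect [of "2 * int L"], simp, subst (asm) sum_even_support)
         (auto simp: odd0 w_neg m_def p_def sum_distrib_left)
    moreover have V_eq: "V = 8 * m 2"
      unfolding V_def
      by (subst expect [of "2 * int L"], simp, subst sum_even_support)
         (auto simp: odd0 w_neg m_def p_def sum_distrib_left power_mult_distrib intro!: sum.cong)
    ultimately have m0: "m 0 = (1 + M) / 2" by simp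
    have "0 \<le> M" using w_nonneg by (simp add: M p_def)
    have "M * m 2 \<le> m 1" "M * m 1 \<le> (1 - M\<^sup>2) / 4"
      using moments unfolding M [symmetric] m0 by (simp_all add: field_simps power2_eq_square)
    \<comment> \<open>Chaining the two bounds eliminates \<open>m 1\<close>. Since
      \<open>V / 2 = 4 * m 2\<close>, the claim follows with nothing lost.\<close>
    then have "M * (M * m 2) \<le> (1 - M\<^sup>2) / 4"
      using mult_left_mono [OF _ \<open>0 \<le> M\<close>] by (meson order_trans)
    then show ?thesis unfolding V V_eq by (simp add: power2_eq_square algebra_simps)
  next
    case False
    define p where "p i = w (2 * int i + 1)" for i
    define m where "m r = (\<Sum>i\<le>L. real i ^ r * p i)" for r
    have even0: "w x = 0" if "even x" for x using w0 that False by simp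
    have M: "M = p 0" using even0 [of 0] by (simp add: M_def p_def flip: w_def)
    have moments: "p 0 * (m 0 + m 1) \<le> m 0 * m 0" "p 0 * (m 1 + m 2) \<le> 2 * m 0 * m 1"
      unfolding m_def
      by (rule log_concave_tail_moments;
          force simp: p_def intro!: even_log_concaveD [OF lc] w0)+
    have m0: "m 0 = 1 / 2"
      using one
      by (subst (asm) expect [of "2 * int L + 1"], simp, subst (asm) sum_odd_support)
         (use w_neg [of "2 * int i + 1" for i] in
           \<open>auto simp: even0 m_def p_def simp flip: sum_distrib_left simp del: minus_add_distrib\<close>)
    have V_eq: "V = 8 * (m 1 + m 2) + 2 * m 0"
    proof -
      have "V = (\<Sum>i\<le>L. 2 * (p i * (2 * real i + 1)\<^sup>2))"
        unfolding V_def
        by (subst expect [of "2 * int L + 1"], simp, subst sum_odd_support)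
           (use w_neg [of "2 * int i + 1" for i] in
             \<open>auto simp: even0 p_def sum.distrib power2_eq_square algebra_simps
                simp del: minus_add_distrib\<close>)
      also have "\<dots> = 8 * (m 1 + m 2) + 2 * m 0"
        unfolding m_def sum.distrib [symmetric] sum_distrib_left
        by (intro sum.cong) (auto simp: power2_eq_square algebra_simps)
      finally show ?thesis .
    qed
    have "0 \<le> M" using w_nonneg by (simp add: M p_def)
    have "M \<le> m 0"
      unfolding m_def M using w_nonneg by (simp, intro member_le_sum) (auto simp: p_def)
    \<comment> \<open>The positive half has mass 1/2, hence \<open>M \<le> 1 / 2\<close>. This lets
      the term \<open>2 * M\<close> gained below absorb \<open>3 / 2 * (M * M)\<close>.\<close>
    then have "M * M \<le> M * (1 / 2)" using \<open>0 \<le> M\<close> m0 by (intro mult_left_mono) auto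
    have "M * (m 1 + m 2) \<le> m 1" "M * m 1 \<le> 1 / 4 - M / 2"
      using moments unfolding M [symmetric] m0 by (simp_all add: field_simps power2_eq_square)
    then have "M * (M * (m 1 + m 2)) \<le> 1 / 4 - M / 2"
      using mult_left_mono [OF _ \<open>0 \<le> M\<close>] by (meson order_trans)
    moreover have "M\<^sup>2 * (1 + V / 2) = 3 / 2 * (M * M) + 4 * (M * (M * (m 1 + m 2)))"
      unfolding V_eq m0 by (simp add: power2_eq_square field_simps)
    ultimately show ?thesis
      unfolding V using \<open>M * M \<le> M * (1 / 2)\<close> \<open>0 \<le> M\<close> by linarith
  qed
qed

text \<open>
  For \<open>t \<ge> 0\<close> this is the maximal probability of \<open>t\<close> points for half the walk; the odd extension to
  negative \<open>t\<close> makes the recursion uniform in \<open>t\<close> and \<open>k\<close>.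
\<close>

definition walk_profile :: "nat list \<Rightarrow> int \<Rightarrow> real" where
  "walk_profile ks t = walk_expect ks (\<lambda>x. sgn (real_of_int (t + x)))"

lemma walk_profile_odd: "walk_profile ks (- t) = - walk_profile ks t"
proof -
  have "walk_profile ks (- t) = walk_expect ks (\<lambda>x. sgn (real_of_int (- t + - x)))"
    unfolding walk_profile_def by (rule walk_expect_reflect [symmetric])
  also have "(\<lambda>x. sgn (real_of_int (- t + - x))) = (\<lambda>x. (-1) * sgn (real_of_int (t + x)))"
    by (simp add: fun_eq_iff sgn_if)
  finally show ?thesis by (simp only: walk_expect_cmult walk_profile_def)
qed

lemma walk_profile_Cons:
  "walk_profile (k # ks) t = (\<Sum>j<k. walk_profile ks (t + (int k - 1 - 2 * int j))) / real k"
  unfolding walk_profile_def walk_expect.simps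
  by (intro arg_cong2[where f = "(/)"] sum.cong refl arg_cong2[where f = walk_expect] ext)
     (simp add: algebra_simps)

text \<open>Averaging over \<open>x\<close> and \<open>- x\<close> turns the sign at
  \<open>t = 1\<close> into a combination of the indicators of \<open>0\<close>, \<open>1\<close>
  and \<open>-1\<close>. The profile at 1 is thus exactly the \<open>M\<close> of the mode
  bound.\<close>

lemma walk_profile_1_le:
  assumes "\<forall>k\<in>set ks. 0 < k"
  shows "walk_profile ks 1 \<le> 1 / sqrt (1 + (\<Sum>k\<leftarrow>ks. (real k ^ 2 - 1) / 6))"
proof -
  define M where "M = walk_mass ks 0 + walk_mass ks 1"
  define s where "s = 1 + (\<Sum>k\<leftarrow>ks. (real k ^ 2 - 1) / 6)"
  have "2 * walk_profile ks 1 =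
      walk_expect ks (\<lambda>x. sgn (real_of_int (1 + x)) + sgn (real_of_int (1 + - x)))"
    unfolding walk_expect_add
      walk_expect_reflect [of ks "\<lambda>x. sgn (real_of_int (1 + x))"] walk_profile_def
    by simp
  also have "(\<lambda>x. sgn (real_of_int (1 + x)) + sgn (real_of_int (1 + - x))) =
      (\<lambda>x. 2 * of_bool (x = 0) + (of_bool (x = 1) + of_bool (x = - 1)))"
    by (rule ext) (auto simp: sgn_if)
  also have "walk_expect ks \<dots> = 2 * M"
    unfolding walk_expect_add walk_expect_cmult walk_mass_def [symmetric] walk_mass_uminus
    by (simp add: M_def)
  finally have "walk_profile ks 1 = M" by simp
  have "1 \<le> s"
    using assms unfolding s_def by (induction ks) (auto simp: Suc_le_eq)
  have "(M * sqrt s)\<^sup>2 \<le> 1"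
    using walk_mode_bound [OF assms] \<open>1 \<le> s\<close> by (simp add: M_def s_def power_mult_distrib)
  then have "M * sqrt s \<le> 1"
    using power2_le_imp_le [of "M * sqrt s" 1] by simp
  then show ?thesis
    using \<open>1 \<le> s\<close> \<open>walk_profile ks 1 = M\<close> by (simp add: s_def [symmetric] field_simps)
qed

section \<open>Rearrangement\<close>

text \<open>
  Peel off the hook \<open>A \<times> {Max B} \<union> {Max A} \<times> B\<close>, on which \<open>a - b\<close> takes \<open>|A| + |B| - 1\<close> distinct values.
  If \<open>|A| < |B|\<close>, the surplus terms on the right cancel because \<open>G\<close> is odd.
\<close>

lemma sum_differences_le:
  fixes f :: "int \<Rightarrow> real" and G :: "int \<Rightarrow> real"
  assumes odd: "\<And>t. G (- t) = - G t"
    and bound: "\<And>C. finite C \<Longrightarrow> (\<Sum>c\<in>C. f c) \<le> G (int (card C))"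
    and "finite A" "finite B"
  shows "(\<Sum>b\<in>B. \<Sum>a\<in>A. f (a - b)) \<le>
    (\<Sum>j<card B. G (int (card A) + (int (card B) - 1 - 2 * int j)))"
  using \<open>finite A\<close> \<open>finite B\<close>
proof (induction "card B" arbitrary: A B)
  case (Suc n)
  show ?case
  proof (cases "A = {}")
    case True
    define k where "k = card B"
    have "(\<Sum>j<k. G (int k - 1 - 2 * int j)) = (\<Sum>j<k. G (- (int k - 1 - 2 * int j)))"
      by (subst sum.nat_diff_reindex [symmetric]) (auto intro!: sum.cong arg_cong[where f = G])
    then have "(\<Sum>j<k. G (int k - 1 - 2 * int j)) = 0"
      by (simp only: odd sum_negf)
    then show ?thesis using True by (simp add: k_def)
  next
    case False
    define p q where "p = Max A" and "q = Max B"
    have "B \<noteq> {}" using Suc.hyps(2) by auto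
    have pA: "p \<in> A" "\<And>a. a \<in> A \<Longrightarrow> a \<le> p" using Suc.prems False by (auto simp: p_def)
    have qB: "q \<in> B" "\<And>b. b \<in> B \<Longrightarrow> b \<le> q" using Suc.prems \<open>B \<noteq> {}\<close> by (auto simp: q_def)
    define C where "C = (\<lambda>a. a - q) ` A \<union> (\<lambda>b. p - b) ` (B - {q})"
    have inj: "inj_on (\<lambda>a. a - q) A" "inj_on (\<lambda>b. p - b) (B - {q})"
      by (auto simp: inj_on_def)
    \<comment> \<open>For \<open>a \<le> p\<close> and \<open>b < q\<close> one has
      \<open>a - q \<le> p - q < p - b\<close>.\<close>
    have disj: "(\<lambda>a. a - q) ` A \<inter> (\<lambda>b. p - b) ` (B - {q}) = {}"
      using pA(2) qB(2) by force
    have card_B': "card (B - {q}) = n" using Suc qB by simp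
    have card_A: "int (card (A - {p})) = int (card A) - 1"
      using pA(1) Suc.prems by (simp add: card_gt_0_iff of_nat_diff Suc_le_eq False)
    have "card C = card A + n"
      unfolding C_def using inj disj Suc.prems card_B'
      by (subst card_Un_disjoint) (auto simp: card_image)
    then have le1: "(\<Sum>c\<in>C. f c) \<le> G (int (card A) + int n)"
      using bound [of C] Suc.prems by (simp add: C_def)
    have sum_C: "(\<Sum>c\<in>C. f c) = (\<Sum>a\<in>A. f (a - q)) + (\<Sum>b\<in>B - {q}. f (p - b))"
      unfolding C_def using inj disj Suc.prems
      by (subst sum.union_disjoint) (auto simp: sum.reindex)
    have "(\<Sum>b\<in>B. \<Sum>a\<in>A. f (a - b)) =
        (\<Sum>a\<in>A. f (a - q)) + (\<Sum>b\<in>B - {q}. f (p - b) + (\<Sum>a\<in>A - {p}. f (a - b)))"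
      using Suc.prems qB(1) pA(1)
      by (subst sum.remove [of B q]) (auto simp: sum.remove [of A p])
    also have "\<dots> = (\<Sum>c\<in>C. f c) + (\<Sum>b\<in>B - {q}. \<Sum>a\<in>A - {p}. f (a - b))"
      by (simp add: sum_C sum.distrib)
    also have "\<dots> \<le> G (int (card A) + int n) +
        (\<Sum>j<n. G (int (card (A - {p})) + (int n - 1 - 2 * int j)))"
      using Suc.hyps(1) [of "B - {q}" "A - {p}"] le1 card_B' Suc.prems by (intro add_mono) auto
    \<comment> \<open>The hook is the term \<open>j = 0\<close>. Both cardinalities drop by 1, which
      shifts the remaining terms by one index.\<close>
    also have "\<dots> = (\<Sum>j<Suc n. G (int (card A) + (int (Suc n) - 1 - 2 * int j)))"
      unfolding sum.lessThan_Suc_shift card_A by (simp add: algebra_simps)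
    finally show ?thesis by (simp only: Suc.hyps(2))
  qed
qed simp

section \<open>Optimal weights under a mass bound\<close>

lemma obtain_top_subset:
  fixes h :: "'a \<Rightarrow> real"
  assumes "finite F" "k \<le> card F"
  obtains B where "B \<subseteq> F" "card B = k" "\<And>b c. b \<in> B \<Longrightarrow> c \<in> F - B \<Longrightarrow> h c \<le> h b"
proof -
  have "\<exists>B\<subseteq>F. card B = k \<and> (\<forall>b\<in>B. \<forall>c\<in>F - B. h c \<le> h b)"
    using assms(2)
  proof (induction k)
    case (Suc k)
    then obtain B where B: "B \<subseteq> F" "card B = k" "\<forall>b\<in>B. \<forall>c\<in>F - B. h c \<le> h b" by auto
    have "finite (F - B)" "F - B \<noteq> {}"
      using assms(1) B Suc.prems by (auto simp: card_Diff_subset dest: card_mono [rotated])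
    then have "Max (h ` (F - B)) \<in> h ` (F - B)" by (intro Max_in) auto
    then obtain x where x: "x \<in> F - B" "Max (h ` (F - B)) = h x" by blast
    have "h c \<le> h x" if "c \<in> F - B" for c
      unfolding x(2) [symmetric] using \<open>finite (F - B)\<close> that by (intro Max_ge) auto
    then show ?case
      using B x(1) finite_subset [OF B(1) assms(1)] by (intro exI [of _ "insert x B"]) auto
  qed (intro exI [of _ "{}"], auto)
  then show ?thesis using that by blast
qed

text \<open>The bathtub principle: with weights at most \<open>1 / k\<close> and total at most 1,
  nothing beats weight \<open>1 / k\<close> on each of the \<open>k\<close> largest values of
  \<open>h\<close>.\<close>

lemma bounded_weight_sum_le:
  fixes g h :: "'a \<Rightarrow> real"
  assumes "finite F" "k \<le> card F" "0 < k"
    and g: "\<And>b. b \<in> F \<Longrightarrow> 0 \<le> g b" "\<And>b. b \<in> F \<Longrightarrow> g b \<le> 1 / real k" "(\<Sum>b\<in>F. g b) \<le> 1"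
    and h: "\<And>b. 0 \<le> h b" and H: "\<And>B. finite B \<Longrightarrow> card B = k \<Longrightarrow> (\<Sum>b\<in>B. h b) \<le> H"
  shows "(\<Sum>b\<in>F. g b * h b) \<le> H / real k"
proof -
  obtain B where B: "B \<subseteq> F" "card B = k" "\<And>b c. b \<in> B \<Longrightarrow> c \<in> F - B \<Longrightarrow> h c \<le> h b"
    using obtain_top_subset [OF assms(1,2), of h] by blast
  have fin: "finite B" and "B \<noteq> {}" using B assms finite_subset by auto
  \<comment> \<open>The threshold: \<open>h - \<tau>\<close> is nonnegative on \<open>B\<close> and
    nonpositive on \<open>F - B\<close>.\<close>
  define \<tau> where "\<tau> = Min (h ` B)"
  have \<tau>: "\<tau> \<le> h b" if "b \<in> B" for b using fin that by (simp add: \<tau>_def)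
  have "\<tau> \<in> h ` B" unfolding \<tau>_def using fin \<open>B \<noteq> {}\<close> by (intro Min_in) auto
  then obtain b0 where b0: "b0 \<in> B" "\<tau> = h b0" by blast
  have "(\<Sum>b\<in>F. g b * h b) \<le> (\<Sum>b\<in>F. g b * \<tau> + (if b \<in> B then (h b - \<tau>) / real k else 0))"
  proof (rule sum_mono)
    fix b assume b: "b \<in> F"
    show "g b * h b \<le> g b * \<tau> + (if b \<in> B then (h b - \<tau>) / real k else 0)"
    proof (cases "b \<in> B")
      case True
      have "g b * (h b - \<tau>) \<le> 1 / real k * (h b - \<tau>)"
        using g(2) [OF b] \<tau> [OF True] by (intro mult_right_mono) auto
      then show ?thesis using True by (simp add: algebra_simps)
    next
      case False
      then show ?thesis using b b0 B(3) g(1) by (auto intro: mult_left_mono)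
    qed
  qed
  also have "\<dots> = (\<Sum>b\<in>F. g b) * \<tau> + (\<Sum>b\<in>B. (h b - \<tau>) / real k)"
    using assms(1) B(1) by (simp add: sum.distrib sum_distrib_right sum.inter_restrict [symmetric] Int_absorb1)
  \<comment> \<open>The total weight may be less than 1, so \<open>0 \<le> \<tau>\<close> matters
    here.\<close>
  also have "\<dots> \<le> \<tau> + (\<Sum>b\<in>B. (h b - \<tau>) / real k)"
    using g(3) h [of b0] b0 by (simp add: mult_left_le_one_le g sum_nonneg)
  also have "\<dots> = (\<Sum>b\<in>B. h b) / real k"
    using B(2) assms(3) by (simp add: sum_subtractf field_simps flip: sum_divide_distrib)
  also have "\<dots> \<le> H / real k" using H [OF fin B(2)] by (simp add: divide_right_mono)
  finally show ?thesis .
qed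

text \<open>The best choice is weight \<open>m\<close> on the largest value and \<open>1 - m\<close>
  on the second. It splits into weight \<open>2 * m - 1\<close> on a single point and weight
  \<open>1 - m\<close> on each of two points.\<close>

lemma heavy_weight_sum_le:
  fixes g h :: "'a \<Rightarrow> real"
  assumes "finite F" "2 \<le> card F"
    and g: "\<And>b. b \<in> F \<Longrightarrow> 0 \<le> g b" "\<And>b. b \<in> F \<Longrightarrow> g b \<le> m" "(\<Sum>b\<in>F. g b) \<le> 1"
    and m: "1 / 2 \<le> m" "m \<le> 1"
    and h: "\<And>b. 0 \<le> h b" and H1: "\<And>b. h b \<le> H1"
    and H2: "\<And>B. finite B \<Longrightarrow> card B = 2 \<Longrightarrow> (\<Sum>b\<in>B. h b) \<le> H2"
  shows "(\<Sum>b\<in>F. g b * h b) \<le> (2 * m - 1) * H1 + (1 - m) * H2"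
proof -
  obtain B where B: "B \<subseteq> F" "card B = 2" "\<And>b c. b \<in> B \<Longrightarrow> c \<in> F - B \<Longrightarrow> h c \<le> h b"
    using obtain_top_subset [OF assms(1,2), of h] by blast
  obtain a c where "B = {a, c}" "a \<noteq> c" using B(2) unfolding card_2_iff by blast
  then obtain p q where pq: "B = {p, q}" "p \<noteq> q" "h q \<le> h p"
    using that [of a c] that [of c a] by (cases "h c \<le> h a") (auto simp: insert_commute)
  have pF: "p \<in> F" using pq B(1) by auto
  have "(\<Sum>b\<in>F. g b * h b) = g p * h p + (\<Sum>b\<in>F - {p}. g b * h b)"
    using assms(1) pF by (rule sum.remove)
  also have "\<dots> \<le> g p * h p + (\<Sum>b\<in>F - {p}. g b * h q)"
  proof (intro add_left_mono sum_mono mult_left_mono)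
    fix b assume b: "b \<in> F - {p}"
    then show "h b \<le> h q" using B(3) [of q b] pq by (cases "b = q") auto
    show "0 \<le> g b" using b g(1) by simp
  qed
  also have "\<dots> = g p * h p + ((\<Sum>b\<in>F. g b) - g p) * h q"
    using sum.remove [OF assms(1) pF, of g] by (simp add: sum_distrib_right)
  also have "\<dots> \<le> g p * h p + (1 - g p) * h q"
    using g(3) h by (intro add_left_mono mult_right_mono) auto
  also have "\<dots> \<le> (2 * m - 1) * h p + (1 - m) * (h p + h q)"
    using mult_right_mono [OF g(2) [OF pF], of "h p - h q"] pq(3) by (simp add: algebra_simps)
  also have "\<dots> \<le> (2 * m - 1) * H1 + (1 - m) * H2"
    using m H1 H2 [of B] B pq by (intro add_mono mult_left_mono) auto
  finally show ?thesis .
qed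

section \<open>Mixtures of walks\<close>

text \<open>
  A summand with maximal mass \<open>m\<close> is compared with the mixture of a constant (weight \<open>1 - l\<close>) and a
  uniform variable on \<open>k\<close> points (weight \<open>l\<close>); \<open>d\<close> is the resulting guaranteed gain in
  \<open>1 / Q\<^sup>2\<close>, stable under averaging over the mixture.
\<close>

definition admissible :: "real \<Rightarrow> nat \<Rightarrow> real \<Rightarrow> bool" where
  "admissible l k d \<longleftrightarrow> 0 \<le> l \<and> l \<le> 1 \<and> 0 < k \<and> 0 \<le> d \<and>
     (\<forall>v\<ge>1. (1 - l) / sqrt v + l / sqrt (v + (real k ^ 2 - 1) / 6) \<le> 1 / sqrt (v + d))"

text \<open>
  The list \<open>xs\<close> holds the steps whose mixture is not resolved yet, \<open>ks\<close> the chosen uniform steps.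
\<close>

fun mixed_profile :: "(real \<times> nat \<times> real) list \<Rightarrow> nat list \<Rightarrow> int \<Rightarrow> real" where
  "mixed_profile [] ks t = walk_profile ks t"
| "mixed_profile ((l, k, d) # xs) ks t =
     (1 - l) * mixed_profile xs ks t + l * mixed_profile xs (k # ks) t"

lemma mixed_profile_odd: "mixed_profile xs ks (- t) = - mixed_profile xs ks t"
  by (induction xs ks t rule: mixed_profile.induct) (simp_all add: walk_profile_odd)

text \<open>Box averages commute with each other and with mixing. A convolution applied outside a
  mixture can therefore be recorded as one more resolved step inside it.\<close>

lemma mixed_profile_shift:
  "mixed_profile xs (k # ks) t =
    (\<Sum>j<k. mixed_profile xs ks (t + (int k - 1 - 2 * int j))) / real k"
proof (induction xs arbitrary: k ks t)
  case (Cons a xs)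
  obtain l k' d where a: "a = (l, k', d)" by (cases a) auto
  define F where "F k ks t = (\<Sum>j<k. mixed_profile xs ks (t + (int k - 1 - 2 * int j))) / real k" for k ks t
  have IH: "mixed_profile xs (k # ks) t = F k ks t" for k ks t
    unfolding F_def by (rule Cons.IH)
  have "F k' (k # ks) t = (\<Sum>j<k. F k' ks (t + (int k - 1 - 2 * int j))) / real k"
    unfolding F_def Cons.IH sum_divide_distrib [symmetric]
    by (subst sum.swap) (simp add: algebra_simps)
  then show ?case
    by (simp add: a IH sum.distrib add_divide_distrib flip: sum_distrib_left) (simp add: F_def)
qed (simp add: walk_profile_Cons)

text \<open>Both branches of an entry are bounded by induction, with the same \<open>v\<close> up to
  the variance term of the new step. Admissibility at this \<open>v \<ge> 1\<close> merges them into
  a gain of \<open>d\<close>.\<close>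

lemma mixed_profile_1_le:
  assumes "\<forall>(l, k, d)\<in>set xs. admissible l k d" "\<forall>k\<in>set ks. 0 < k"
  shows "mixed_profile xs ks 1 \<le>
    1 / sqrt (1 + (\<Sum>k\<leftarrow>ks. (real k ^ 2 - 1) / 6) + (\<Sum>(l, k, d)\<leftarrow>xs. d))"
  using assms
proof (induction xs arbitrary: ks)
  case Nil
  then show ?case by (simp add: walk_profile_1_le)
next
  case (Cons a xs)
  obtain l k d where a: "a = (l, k, d)" by (cases a) auto
  define v where "v = 1 + (\<Sum>k\<leftarrow>ks. (real k ^ 2 - 1) / 6) + (\<Sum>(l, k, d)\<leftarrow>xs. d)"
  have adm: "admissible l k d" using Cons.prems a by auto
  have "0 \<le> (\<Sum>k\<leftarrow>ks. (real k ^ 2 - 1) / 6)"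
    using Cons.prems(2) by (intro sum_list_nonneg) (auto simp: Suc_le_eq)
  moreover have "0 \<le> (\<Sum>(l, k, d)\<leftarrow>xs. d)"
    using Cons.prems(1) by (intro sum_list_nonneg) (auto simp: admissible_def)
  ultimately have "1 \<le> v" by (simp add: v_def)
  have "mixed_profile (a # xs) ks 1 \<le>
      (1 - l) * (1 / sqrt v) + l * (1 / sqrt (v + (real k ^ 2 - 1) / 6))"
    using adm Cons.IH [of ks] Cons.IH [of "k # ks"] Cons.prems unfolding a mixed_profile.simps
    by (intro add_mono mult_left_mono) (auto simp: admissible_def v_def algebra_simps)
  also have "\<dots> \<le> 1 / sqrt (v + d)"
    using adm \<open>1 \<le> v\<close> by (auto simp: admissible_def)
  finally show ?case by (simp add: a v_def add_ac)
qed

section \<open>Gains of a single summand\<close>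

lemma admissible_uniform:
  assumes "2 \<le> k" and m: "1 / (real k + 1) < m" "m \<le> 1"
  shows "admissible 1 k ((1 / m\<^sup>2 - 1) / 20)"
proof -
  have "0 < m" using m(1) by (smt (verit) divide_pos_pos of_nat_0_le_iff)
  have "1 / m < real k + 1"
    using m(1) \<open>0 < m\<close> by (simp add: field_simps)
  then have "(1 / m)\<^sup>2 \<le> (real k + 1)\<^sup>2" using \<open>0 < m\<close> by (intro power_mono) auto
  then have "(1 / m\<^sup>2 - 1) / 20 \<le> ((real k + 1)\<^sup>2 - 1) / 20"
    by (simp add: power_divide)
  \<comment> \<open>Since \<open>1 / m < k + 1\<close>, it suffices that
    \<open>((k + 1)^2 - 1) / 20 \<le> (k^2 - 1) / 6\<close>, that is
    \<open>7 * k^2 - 6 * k - 10 \<ge> 0\<close>. The product equals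
    \<open>7 * k^2 - 6 * k - 16\<close>.\<close>
  moreover have "0 \<le> (real k - 2) * (7 * real k + 8)" using assms(1) by (intro mult_nonneg_nonneg) auto
  ultimately have le: "(1 / m\<^sup>2 - 1) / 20 \<le> (real k ^ 2 - 1) / 6"
    by (elim order_trans) (simp add: power2_eq_square field_simps)
  moreover have "m\<^sup>2 \<le> 1" using \<open>0 < m\<close> m by (simp add: power_le_one)
  then have "1 \<le> 1 / m\<^sup>2" using \<open>0 < m\<close> by simp
  ultimately have d: "0 \<le> (1 / m\<^sup>2 - 1) / 20" "(1 / m\<^sup>2 - 1) / 20 \<le> (real k ^ 2 - 1) / 6"
    by simp_all
  show ?thesis
    unfolding admissible_def
  proof (intro conjI allI impI)
    fix v :: real assume v: "1 \<le> v"
    have "1 / sqrt (v + (real k ^ 2 - 1) / 6) \<le> 1 / sqrt (v + (1 / m\<^sup>2 - 1) / 20)"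
      using d v by (intro divide_left_mono mult_pos_pos real_sqrt_gt_zero real_sqrt_le_mono) linarith+
    then show "(1 - 1) / sqrt v + 1 / sqrt (v + (real k ^ 2 - 1) / 6) \<le>
        1 / sqrt (v + (1 / m\<^sup>2 - 1) / 20)"
      by simp
  qed (use d assms(1) in auto)
qed

text \<open>Here \<open>k = 2\<close> and the variance term is \<open>1 / 2\<close>. Both sides are
  compared with linear expressions over \<open>sqrt v\<close>: an upper bound for the uniform branch
  and the tangent of \<open>1 / sqrt (v + d)\<close> at \<open>d = 0\<close>. The bound
  \<open>d \<le> 3 / 20 * l\<close> leaves ample room between them.\<close>

lemma admissible_heavy:
  assumes m: "1 / 2 \<le> m" "m \<le> 1"
  shows "admissible (2 * (1 - m)) 2 ((1 / m\<^sup>2 - 1) / 20)"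
  unfolding admissible_def
proof (intro conjI allI impI)
  define l d where "l = 2 * (1 - m)" and "d = (1 / m\<^sup>2 - 1) / 20"
  have l: "0 \<le> l" "l \<le> 1" using m by (auto simp: l_def)
  have "m\<^sup>2 \<le> 1" using m by (simp add: power_le_one)
  then have "1 \<le> 1 / m\<^sup>2" using m by simp
  then show "0 \<le> (1 / m\<^sup>2 - 1) / 20" by simp
  \<comment> \<open>This is the factorisation of
    \<open>6 * (1 - m) * m\<^sup>2 - (1 - m\<^sup>2)\<close>.\<close>
  have "0 \<le> (2 * m - 1) * (3 * m + 1) * (1 - m)"
    using m by (intro mult_nonneg_nonneg) auto
  then have "1 - m\<^sup>2 \<le> 6 * (1 - m) * m\<^sup>2"
    by (simp add: power2_eq_square algebra_simps)
  then have "1 / m\<^sup>2 - 1 \<le> 6 * (1 - m)" using m by (simp add: field_simps)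
  then have d: "d \<le> 3 / 20 * l" "0 \<le> d"
    using \<open>1 \<le> 1 / m\<^sup>2\<close> by (auto simp: d_def l_def)
  fix v :: real assume v: "1 \<le> v"
  define s where "s = sqrt v"
  have s: "1 \<le> s" "s\<^sup>2 = v" using v by (auto simp: s_def)
  have drop: "1 / sqrt (v + 1 / 2) \<le> (1 - 1 / (4 * v + 2)) / s"
  proof -
    have "(s / sqrt (v + 1 / 2))\<^sup>2 = 1 - 1 / (2 * v + 1)"
      using v s by (simp add: power_divide field_simps)
    also have "1 / (2 * v + 1) = 2 * (1 / (4 * v + 2))" using v by (simp add: field_simps)
    also have "1 - 2 * x \<le> (1 - x)\<^sup>2" for x :: real
      by (simp add: power2_eq_square algebra_simps)
    finally have "s / sqrt (v + 1 / 2) \<le> 1 - 1 / (4 * v + 2)"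
      by (rule power2_le_imp_le) (use v in \<open>simp add: field_simps\<close>)
    then show ?thesis using s by (subst pos_le_divide_eq) auto
  qed
  \<comment> \<open>By convexity the tangent lies below the curve. After squaring, with
    \<open>x = d / (2 * v)\<close>, this is \<open>(1 - x)^2 * (1 + 2 * x) \<le> 1\<close>; for
    \<open>x > 1\<close> the left side is negative.\<close>
  have tangent: "(1 - d / (2 * v)) / s \<le> 1 / sqrt (v + d)"
  proof (cases "d / (2 * v) \<le> 1")
    case True
    have *: "(1 - x) ^ 2 * (1 + 2 * x) \<le> 1" if "0 \<le> x" "x \<le> 1" for x :: real
    proof -
      have "0 \<le> x\<^sup>2 * (3 - 2 * x)" using that by (intro mult_nonneg_nonneg) auto
      then show ?thesis by (simp add: power2_eq_square algebra_simps)
    qed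
    have "((1 - d / (2 * v)) * sqrt (v + d) / s)\<^sup>2 = (1 - d / (2 * v))\<^sup>2 * (1 + 2 * (d / (2 * v)))"
      using v s d by (simp add: power_divide power_mult_distrib) (simp add: field_simps)
    also have "\<dots> \<le> 1\<^sup>2" using * [of "d / (2 * v)"] True d v by simp
    finally have "(1 - d / (2 * v)) * sqrt (v + d) / s \<le> 1" by (rule power2_le_imp_le) simp
    then show ?thesis using s v d by (simp add: field_simps)
  next
    case False
    then have "(1 - d / (2 * v)) / s \<le> 0" using s by (simp add: divide_nonpos_pos)
    also have "0 \<le> 1 / sqrt (v + d)" using v d by simp
    finally show ?thesis .
  qed
  have "(1 - l) / s + l / sqrt (v + 1 / 2) \<le> (1 - l) / s + l * ((1 - 1 / (4 * v + 2)) / s)"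
    using mult_left_mono [OF drop l(1)] by simp
  also have "\<dots> = (1 - l / (4 * v + 2)) / s"
    using s v by (simp add: diff_divide_distrib algebra_simps)
  also have "\<dots> \<le> (1 - d / (2 * v)) / s"
  proof -
    have "d / (2 * v) \<le> (3 / 20 * l) / (2 * v)" using d v by (intro divide_right_mono) auto
    also have "\<dots> \<le> l / (4 * v + 2)"
      using v l mult_left_mono [of 1 v l] by (simp add: field_simps)
    finally show ?thesis using s by (intro divide_right_mono) auto
  qed
  also note tangent
  finally show "(1 - 2 * (1 - m)) / sqrt v + 2 * (1 - m) / sqrt (v + (real 2 ^ 2 - 1) / 6) \<le>
      1 / sqrt (v + (1 / m\<^sup>2 - 1) / 20)"
    by (simp add: l_def d_def s_def)
qed (use m in auto)

text \<open>In the application \<open>g\<close> is the mass function of the new summand and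
  \<open>h b\<close> the probability that the old sum shifted by \<open>b\<close> hits a given set.
  The form covers both ranges of \<open>m\<close> at once.\<close>

definition spread_bound :: "real \<Rightarrow> real \<Rightarrow> nat \<Rightarrow> bool" where
  "spread_bound m l k \<longleftrightarrow>
     (\<forall>F (g :: int \<Rightarrow> real) h H1 Hk. finite F \<and> k \<le> card F \<and> (\<forall>b\<in>F. 0 \<le> g b \<and> g b \<le> m) \<and>
        (\<Sum>b\<in>F. g b) \<le> 1 \<and> (\<forall>b. 0 \<le> h b \<and> h b \<le> H1) \<and>
        (\<forall>B. finite B \<longrightarrow> card B = k \<longrightarrow> (\<Sum>b\<in>B. h b) \<le> Hk) \<longrightarrow>
        (\<Sum>b\<in>F. g b * h b) \<le> (1 - l) * H1 + l * (Hk / real k))"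

lemma exists_admissible:
  fixes m :: real
  assumes "0 < m" "m \<le> 1"
  shows "\<exists>l k. admissible l k ((1 / m\<^sup>2 - 1) / 20) \<and> spread_bound m l k"
proof (cases "1 / 2 < m")
  case True
  have "admissible (2 * (1 - m)) 2 ((1 / m\<^sup>2 - 1) / 20)"
    using True assms by (intro admissible_heavy) auto
  moreover have "spread_bound m (2 * (1 - m)) 2"
    unfolding spread_bound_def
  proof (intro allI impI, elim conjE)
    fix F and g h :: "int \<Rightarrow> real" and H1 Hk
    assume *: "finite F" "2 \<le> card F" "\<forall>b\<in>F. 0 \<le> g b \<and> g b \<le> m" "(\<Sum>b\<in>F. g b) \<le> 1"
      "\<forall>b. 0 \<le> h b \<and> h b \<le> H1" "\<forall>B. finite B \<longrightarrow> card B = 2 \<longrightarrow> (\<Sum>b\<in>B. h b) \<le> Hk"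
    have "(\<Sum>b\<in>F. g b * h b) \<le> (2 * m - 1) * H1 + (1 - m) * Hk"
      using True assms * by (intro heavy_weight_sum_le) auto
    then show "(\<Sum>b\<in>F. g b * h b) \<le> (1 - 2 * (1 - m)) * H1 + 2 * (1 - m) * (Hk / real 2)"
      by (simp add: algebra_simps)
  qed
  ultimately show ?thesis by blast
next
  case False
  \<comment> \<open>The integer part places \<open>m\<close> in the interval from
    \<open>1 / (k + 1)\<close>, excluded, to \<open>1 / k\<close>.\<close>
  define k where "k = nat \<lfloor>1 / m\<rfloor>"
  have "2 \<le> 1 / m" using False assms by (simp add: field_simps)
  then have k: "2 \<le> k" "real k \<le> 1 / m" "1 / m < real k + 1"
    unfolding k_def by linarith+
  then have mk: "1 / (real k + 1) < m" "m \<le> 1 / real k"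
    using assms by (simp_all add: field_simps)
  have "admissible 1 k ((1 / m\<^sup>2 - 1) / 20)"
    using k mk assms by (intro admissible_uniform) auto
  moreover have "spread_bound m 1 k"
    unfolding spread_bound_def
  proof (intro allI impI, elim conjE)
    fix F and g h :: "int \<Rightarrow> real" and H1 Hk
    assume *: "finite F" "k \<le> card F" "\<forall>b\<in>F. 0 \<le> g b \<and> g b \<le> m" "(\<Sum>b\<in>F. g b) \<le> 1"
      "\<forall>b. 0 \<le> h b \<and> h b \<le> H1" "\<forall>B. finite B \<longrightarrow> card B = k \<longrightarrow> (\<Sum>b\<in>B. h b) \<le> Hk"
    have "g b \<le> 1 / real k" if "b \<in> F" for b
      using * mk(2) that by (meson order_trans)
    then have "(\<Sum>b\<in>F. g b * h b) \<le> Hk / real k"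
      using * k by (intro bounded_weight_sum_le) auto
    then show "(\<Sum>b\<in>F. g b * h b) \<le> (1 - 1) * H1 + 1 * (Hk / real k)" by simp
  qed
  ultimately show ?thesis by blast
qed

lemma measurable_int_sum:
  fixes X :: "'i \<Rightarrow> 'a \<Rightarrow> int"
  assumes "finite I" "\<And>i. i \<in> I \<Longrightarrow> X i \<in> measurable N (count_space UNIV)"
  shows "(\<lambda>\<omega>. \<Sum>i\<in>I. X i \<omega>) \<in> measurable N (count_space UNIV)"
  using assms
proof (induction I)
  case (insert i I)
  then have sum: "(\<lambda>\<omega>. \<Sum>i\<in>I. X i \<omega>) \<in> measurable N (count_space UNIV)" by simp
  have "(\<lambda>\<omega>. c + (\<Sum>i\<in>I. X i \<omega>)) \<in> measurable N (count_space UNIV)" for c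
    by (rule measurable_compose [OF sum]) simp
  moreover have "X i \<in> measurable N (count_space UNIV)" using insert.prems by simp
  ultimately have "(\<lambda>\<omega>. X i \<omega> + (\<Sum>i\<in>I. X i \<omega>)) \<in> measurable N (count_space UNIV)"
    by (rule measurable_compose_countable)
  then show ?case using insert.hyps by simp
qed simp

section \<open>Concentration of independent sums\<close>

context prob_space
begin

abbreviation int_rv :: "('a \<Rightarrow> int) \<Rightarrow> bool" where
  "int_rv X \<equiv> X \<in> measurable M (count_space UNIV)"

lemma prob_int_finite_set:
  assumes "int_rv X" "finite F"
  shows "\<P>(\<omega> in M. X \<omega> \<in> F) = (\<Sum>k\<in>F. mass_fun M X k)"
proof -
  have "prob (\<Union>k\<in>F. {\<omega> \<in> space M. X \<omega> = k}) = (\<Sum>k\<in>F. prob {\<omega> \<in> space M. X \<omega> = k})"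
    using assms by (intro finite_measure_finite_Union) (auto simp: disjoint_family_on_def)
  moreover have "(\<Union>k\<in>F. {\<omega> \<in> space M. X \<omega> = k}) = {\<omega> \<in> space M. X \<omega> \<in> F}" by auto
  ultimately show ?thesis by (simp add: mass_fun_def)
qed

text \<open>Supports may be infinite. This cuts them to a finite window at the cost of an
  arbitrarily small error.\<close>

lemma prob_int_tight:
  assumes "int_rv X" "0 < e"
  obtains N0 where "\<And>N :: nat. N0 \<le> N \<Longrightarrow> \<P>(\<omega> in M. X \<omega> \<notin> {- int N..int N}) < e"
proof -
  define A where "A N = {\<omega> \<in> space M. X \<omega> \<notin> {- int N..int N}}" for N
  have "(\<lambda>N. prob (A N)) \<longlonglongrightarrow> prob (\<Inter>N. A N)"
    using assms(1) by (intro finite_Lim_measure_decseq) (auto simp: A_def decseq_def)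
  moreover have "(\<Inter>N. A N) = {}"
  proof -
    have "\<omega> \<notin> A (nat \<bar>X \<omega>\<bar>)" for \<omega> by (auto simp: A_def)
    then show ?thesis by blast
  qed
  ultimately have "(\<lambda>N. prob (A N)) \<longlonglongrightarrow> 0" by simp
  then have "\<forall>\<^sub>F N in sequentially. prob (A N) < e"
    using assms(2) by (rule order_tendstoD)
  then show thesis using that unfolding eventually_sequentially A_def by blast
qed

lemma mass_fun_le_mass_sup: "mass_fun M X k \<le> mass_sup M X"
  unfolding mass_sup_def
  by (intro cSUP_upper bdd_aboveI [of _ 1]) (auto simp: mass_fun_def)

lemma mass_sup_le_1: "mass_sup M X \<le> 1"
  unfolding mass_sup_def by (intro cSUP_least) (auto simp: mass_fun_def)

text \<open>If every mass vanished, each finite window would have probability 0, against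
  tightness.\<close>

lemma mass_sup_pos:
  assumes "int_rv X"
  shows "0 < mass_sup M X"
proof (rule ccontr)
  assume "\<not> 0 < mass_sup M X"
  then have zero: "mass_fun M X k = 0" for k
    using mass_fun_le_mass_sup [of X k] by (simp add: mass_fun_def antisym measure_nonneg)
  obtain N where N: "\<P>(\<omega> in M. X \<omega> \<notin> {- int N..int N}) < 1"
    using prob_int_tight [OF assms, of 1] by auto
  have "\<P>(\<omega> in M. X \<omega> \<notin> {- int N..int N}) = 1 - \<P>(\<omega> in M. X \<omega> \<in> {- int N..int N})"
    using assms by (intro prob_neg) simp
  moreover have "\<P>(\<omega> in M. X \<omega> \<in> {- int N..int N}) = 0"
    using prob_int_finite_set [OF assms, of "{- int N..int N}"] zero by simp
  ultimately show False using N by simp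
qed

lemma prob_add_int_le:
  assumes indep: "indep_var (count_space UNIV) X (count_space UNIV) S" and "finite F"
  shows "\<P>(\<omega> in M. S \<omega> + X \<omega> \<in> A) \<le>
    (\<Sum>b\<in>F. mass_fun M X b * \<P>(\<omega> in M. S \<omega> + b \<in> A)) + \<P>(\<omega> in M. X \<omega> \<notin> F)"
proof -
  have [measurable]: "int_rv X" "int_rv S"
    using indep by (auto dest: indep_var_rv1 indep_var_rv2)
  have split: "{\<omega> \<in> space M. S \<omega> + X \<omega> \<in> A} \<subseteq>
      (\<Union>b\<in>F. {\<omega> \<in> space M. X \<omega> = b \<and> S \<omega> + b \<in> A}) \<union> {\<omega> \<in> space M. X \<omega> \<notin> F}"
    by auto
  have "\<P>(\<omega> in M. S \<omega> + X \<omega> \<in> A) \<le>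
      prob ((\<Union>b\<in>F. {\<omega> \<in> space M. X \<omega> = b \<and> S \<omega> + b \<in> A}) \<union> {\<omega> \<in> space M. X \<omega> \<notin> F})"
    using \<open>finite F\<close> by (intro finite_measure_mono split sets.Un sets.finite_UN) auto
  also have "\<dots> \<le> prob (\<Union>b\<in>F. {\<omega> \<in> space M. X \<omega> = b \<and> S \<omega> + b \<in> A}) +
      \<P>(\<omega> in M. X \<omega> \<notin> F)"
    using \<open>finite F\<close> by (intro measure_Un_le sets.finite_UN) auto
  also have "prob (\<Union>b\<in>F. {\<omega> \<in> space M. X \<omega> = b \<and> S \<omega> + b \<in> A}) =
      (\<Sum>b\<in>F. \<P>(\<omega> in M. X \<omega> = b \<and> S \<omega> + b \<in> A))"
    using \<open>finite F\<close>
    by (intro finite_measure_finite_Union) (auto simp: disjoint_family_on_def)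
  also have "\<dots> = (\<Sum>b\<in>F. mass_fun M X b * \<P>(\<omega> in M. S \<omega> + b \<in> A))"
  proof (intro sum.cong refl)
    fix b
    have "prob ((\<lambda>x. (X x, S x)) -` ({b} \<times> {s. s + b \<in> A}) \<inter> space M) =
        prob (X -` {b} \<inter> space M) * prob (S -` {s. s + b \<in> A} \<inter> space M)"
      using indep by (rule indep_varD) auto
    then show "\<P>(\<omega> in M. X \<omega> = b \<and> S \<omega> + b \<in> A) =
        mass_fun M X b * \<P>(\<omega> in M. S \<omega> + b \<in> A)"
      by (simp add: mass_fun_def vimage_def Int_def conj_commute mem_Times_iff)
  qed
  finally show ?thesis .
qed

text \<open>One summand at a time: conditioning on \<open>X\<close> gives a sum linear in its
  masses, to which \<open>spread_bound\<close> applies. The sums over \<open>k\<close> shifts are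
  controlled by the rearrangement inequality. The pair \<open>l\<close>, \<open>k\<close> is chosen
  before \<open>A\<close>, so the new bound is again a profile.\<close>

lemma prob_add_profile_le:
  assumes indep: "indep_var (count_space UNIV) X (count_space UNIV) S"
    and odd: "\<And>t. G (- t) = - G t"
    and G: "\<And>A. finite A \<Longrightarrow> \<P>(\<omega> in M. S \<omega> \<in> A) \<le> G (int (card A))"
  shows "\<exists>l k. admissible l k ((1 / (mass_sup M X)\<^sup>2 - 1) / 20) \<and>
    (\<forall>A. finite A \<longrightarrow> \<P>(\<omega> in M. S \<omega> + X \<omega> \<in> A) \<le> (1 - l) * G (int (card A)) +
      l * ((\<Sum>j<k. G (int (card A) + (int k - 1 - 2 * int j))) / real k))"
proof -
  have rv: "int_rv X" "int_rv S"
    using indep by (auto dest: indep_var_rv1 indep_var_rv2)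
  obtain l k where lk: "admissible l k ((1 / (mass_sup M X)\<^sup>2 - 1) / 20)"
    and spread: "spread_bound (mass_sup M X) l k"
    using exists_admissible [OF mass_sup_pos [OF rv(1)] mass_sup_le_1] by blast
  have "\<P>(\<omega> in M. S \<omega> + X \<omega> \<in> A) \<le> (1 - l) * G (int (card A)) +
      l * ((\<Sum>j<k. G (int (card A) + (int k - 1 - 2 * int j))) / real k)" (is "_ \<le> ?R")
    if "finite A" for A
  proof (rule field_le_epsilon)
    fix e :: real assume "0 < e"
    obtain N0 where N0: "\<And>N :: nat. N0 \<le> N \<Longrightarrow> \<P>(\<omega> in M. X \<omega> \<notin> {- int N..int N}) < e"
      using prob_int_tight [OF rv(1) \<open>0 < e\<close>] by blast
    \<comment> \<open>Besides being large for tightness, the window must contain at least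
      \<open>k\<close> points.\<close>
    define N where "N = max N0 k"
    define F where "F = {- int N..int N}"
    have shifted: "\<P>(\<omega> in M. S \<omega> + b \<in> A) = (\<Sum>a\<in>A. mass_fun M S (a - b))" for b
    proof -
      have "{\<omega> \<in> space M. S \<omega> + b \<in> A} = {\<omega> \<in> space M. S \<omega> \<in> (\<lambda>a. a - b) ` A}"
        by (auto simp: image_iff) (metis add_diff_cancel_right')
      then show ?thesis
        using prob_int_finite_set [OF rv(2), of "(\<lambda>a. a - b) ` A"] that
        by (simp add: sum.reindex inj_on_def)
    qed
    have single: "\<P>(\<omega> in M. S \<omega> + b \<in> A) \<le> G (int (card A))" for b
      using G [of "(\<lambda>a. a - b) ` A"] prob_int_finite_set [OF rv(2), of "(\<lambda>a. a - b) ` A"] that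
      by (simp add: shifted sum.reindex card_image inj_on_def)
    have multi: "(\<Sum>b\<in>B. \<P>(\<omega> in M. S \<omega> + b \<in> A)) \<le>
        (\<Sum>j<k. G (int (card A) + (int k - 1 - 2 * int j)))" if "finite B" "card B = k" for B
      unfolding shifted that(2) [symmetric]
      using odd G prob_int_finite_set [OF rv(2)] \<open>finite A\<close> that(1)
      by (intro sum_differences_le) auto
    have total: "(\<Sum>b\<in>F. mass_fun M X b) \<le> 1"
      unfolding F_def by (subst prob_int_finite_set [OF rv(1), symmetric]) auto
    have "\<P>(\<omega> in M. S \<omega> + X \<omega> \<in> A) \<le>
      (\<Sum>b\<in>F. mass_fun M X b * \<P>(\<omega> in M. S \<omega> + b \<in> A)) + \<P>(\<omega> in M. X \<omega> \<notin> F)"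
      by (intro prob_add_int_le indep) (simp add: F_def)
    also have "(\<Sum>b\<in>F. mass_fun M X b * \<P>(\<omega> in M. S \<omega> + b \<in> A)) \<le> ?R"
      using total single multi
      by (intro spread [unfolded spread_bound_def, rule_format])
         (auto simp: F_def N_def mass_fun_le_mass_sup [unfolded mass_fun_def] mass_fun_def)
    also have "\<P>(\<omega> in M. X \<omega> \<notin> F) \<le> e"
      using N0 [of N] by (simp add: F_def N_def)
    finally show "\<P>(\<omega> in M. S \<omega> + X \<omega> \<in> A) \<le> ?R + e" by simp
  qed
  with lk show ?thesis by blast
qed

lemma indep_var_int_sum:
  fixes X :: "'i \<Rightarrow> 'a \<Rightarrow> int"
  assumes "finite I" "i \<notin> I" and indep: "indep_vars (\<lambda>_. count_space UNIV) X (insert i I)"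
  shows "indep_var (count_space UNIV) (X i) (count_space UNIV) (\<lambda>\<omega>. \<Sum>j\<in>I. X j \<omega>)"
proof -
  have sums: "(\<lambda>f. \<Sum>j\<in>I. f j :: int) \<in> measurable (PiM I (\<lambda>_. count_space UNIV)) (count_space UNIV)"
    using \<open>finite I\<close> by (intro measurable_int_sum) auto
  have "indep_var
    (count_space UNIV) ((\<lambda>f. f i) \<circ> (\<lambda>\<omega>. restrict (\<lambda>i. X i \<omega>) {i}))
    (count_space UNIV) ((\<lambda>f. \<Sum>j\<in>I. f j) \<circ> (\<lambda>\<omega>. restrict (\<lambda>i. X i \<omega>) I))"
    using assms by (intro indep_var_compose [OF indep_var_restrict [OF indep]] sums) auto
  also have "(\<lambda>f. f i) \<circ> (\<lambda>\<omega>. restrict (\<lambda>i. X i \<omega>) {i}) = X i" by auto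
  also have "(\<lambda>f. \<Sum>j\<in>I. f j) \<circ> (\<lambda>\<omega>. restrict (\<lambda>i. X i \<omega>) I) = (\<lambda>\<omega>. \<Sum>j\<in>I. X j \<omega>)"
    by (rule ext) simp
  finally show ?thesis .
qed

lemma sum_profile_bound:
  fixes X :: "nat \<Rightarrow> 'a \<Rightarrow> int"
  assumes "indep_vars (\<lambda>_. count_space UNIV) X {1..n}"
  shows "\<exists>xs. (\<forall>(l, k, d)\<in>set xs. admissible l k d) \<and>
    (\<Sum>(l, k, d)\<leftarrow>xs. d) = (\<Sum>i=1..n. (1 / (mass_sup M (X i))\<^sup>2 - 1) / 20) \<and>
    (\<forall>A. finite A \<longrightarrow> \<P>(\<omega> in M. (\<Sum>i=1..n. X i \<omega>) \<in> A) \<le> mixed_profile xs [] (int (card A)))"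
  using assms
proof (induction n)
  case 0
  \<comment> \<open>The empty profile is \<open>sgn\<close>, which is 0 for the empty set and 1 for
    every other.\<close>
  have "\<P>(\<omega> in M. (\<Sum>i=1..0. X i \<omega>) \<in> A) \<le> mixed_profile [] [] (int (card A))" if "finite A" for A
    using that by (cases "A = {}") (auto simp: walk_profile_def sgn_if)
  then show ?case by (intro exI [of _ "[]"]) auto
next
  case (Suc n)
  have ins: "{1..Suc n} = insert (Suc n) {1..n}" by auto
  have "indep_vars (\<lambda>_. count_space UNIV) X {1..n}"
    using Suc.prems by (rule indep_vars_subset) auto
  from Suc.IH [OF this] obtain xs where xs: "\<forall>(l, k, d)\<in>set xs. admissible l k d"
    "(\<Sum>(l, k, d)\<leftarrow>xs. d) = (\<Sum>i=1..n. (1 / (mass_sup M (X i))\<^sup>2 - 1) / 20)"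
    "\<And>A. finite A \<Longrightarrow> \<P>(\<omega> in M. (\<Sum>i=1..n. X i \<omega>) \<in> A) \<le> mixed_profile xs [] (int (card A))"
    by blast
  have "indep_var (count_space UNIV) (X (Suc n)) (count_space UNIV) (\<lambda>\<omega>. \<Sum>i=1..n. X i \<omega>)"
    using Suc.prems unfolding ins by (intro indep_var_int_sum) auto
  from prob_add_profile_le [where G = "mixed_profile xs []", OF this mixed_profile_odd xs(3)]
  obtain l k where lk: "admissible l k ((1 / (mass_sup M (X (Suc n)))\<^sup>2 - 1) / 20)"
    "\<And>A. finite A \<Longrightarrow> \<P>(\<omega> in M. (\<Sum>i=1..n. X i \<omega>) + X (Suc n) \<omega> \<in> A) \<le>
      (1 - l) * mixed_profile xs [] (int (card A)) +
      l * ((\<Sum>j<k. mixed_profile xs [] (int (card A) + (int k - 1 - 2 * int j))) / real k)"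
    by blast
  let ?y = "(l, k, (1 / (mass_sup M (X (Suc n)))\<^sup>2 - 1) / 20)"
  have "\<P>(\<omega> in M. (\<Sum>i=1..Suc n. X i \<omega>) \<in> A) \<le> mixed_profile (?y # xs) [] (int (card A))"
    if "finite A" for A
    using lk(2) [OF that] unfolding mixed_profile.simps mixed_profile_shift by simp
  moreover have "(\<Sum>(l, k, d)\<leftarrow>?y # xs. d) =
      (\<Sum>i=1..Suc n. (1 / (mass_sup M (X i))\<^sup>2 - 1) / 20)"
    using xs(2) by simp
  moreover have "\<forall>(l, k, d)\<in>set (?y # xs). admissible l k d"
    using xs(1) lk(1) by simp
  ultimately show ?case by blast
qed

lemma Delta_inf_eq:
  assumes "int_rv X"
  shows "Delta_inf M X = 1 / (mass_sup M X)\<^sup>2 - 1"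
proof -
  have "exp (2 * - ln (mass_sup M X)) = (exp (- ln (mass_sup M X)))\<^sup>2" by (rule exp_double)
  then show ?thesis
    using mass_sup_pos [OF assms]
    by (simp add: Delta_inf_def min_entropy_def exp_minus power_one_over inverse_eq_divide)
qed

end

theorem mainTheorem4:
  fixes M :: "'a measure" and X :: "nat \<Rightarrow> 'a \<Rightarrow> int" and n :: nat
  assumes "prob_space M"
    and "n \<ge> 1"
    and "prob_space.indep_vars M (\<lambda>_. count_space UNIV) X {1..n}"
  shows "Delta_inf M (\<lambda>\<omega>. \<Sum>i=1..n. X i \<omega>) \<ge> (1 / 20) * (\<Sum>i=1..n. Delta_inf M (X i))"
proof -
  interpret prob_space M by fact
  define S where "S = (\<lambda>\<omega>. \<Sum>i=1..n. X i \<omega>)"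
  have rv: "int_rv (X i)" if "i \<in> {1..n}" for i
    using assms(3) that by (auto simp: indep_vars_def)
  then have "int_rv S" unfolding S_def by (intro measurable_int_sum) auto
  obtain xs where xs: "\<forall>(l, k, d)\<in>set xs. admissible l k d"
    "(\<Sum>(l, k, d)\<leftarrow>xs. d) = (\<Sum>i=1..n. (1 / (mass_sup M (X i))\<^sup>2 - 1) / 20)"
    "\<And>A. finite A \<Longrightarrow> \<P>(\<omega> in M. S \<omega> \<in> A) \<le> mixed_profile xs [] (int (card A))"
    using sum_profile_bound [OF assms(3)] unfolding S_def by blast
  define D where "D = (\<Sum>i=1..n. (1 / (mass_sup M (X i))\<^sup>2 - 1) / 20)"
  have D: "(1 / 20) * (\<Sum>i=1..n. Delta_inf M (X i)) = D"
    using rv by (simp add: D_def Delta_inf_eq sum_divide_distrib)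
  have "0 \<le> D"
    unfolding D_def xs(2) [symmetric]
    using xs(1) by (intro sum_list_nonneg) (auto simp: admissible_def)
  \<comment> \<open>Singletons have \<open>t = 1\<close>, so the profile at 1 bounds every point
    mass.\<close>
  have "mass_sup M S \<le> mixed_profile xs [] 1"
    unfolding mass_sup_def using xs(3) [of "{k}" for k] by (intro cSUP_least) (auto simp: mass_fun_def)
  also have "\<dots> \<le> 1 / sqrt (1 + D)"
    using mixed_profile_1_le [OF xs(1), of "[]"] by (simp add: xs(2) D_def)
  finally have "(mass_sup M S)\<^sup>2 \<le> (1 / sqrt (1 + D))\<^sup>2"
    using mass_sup_pos [OF \<open>int_rv S\<close>] by (intro power_mono) auto
  then have "1 + D \<le> 1 / (mass_sup M S)\<^sup>2"
    using \<open>0 \<le> D\<close> mass_sup_pos [OF \<open>int_rv S\<close>] by (simp add: power_divide field_simps)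
  then show ?thesis
    unfolding D S_def [symmetric] Delta_inf_eq [OF \<open>int_rv S\<close>] by linarith
qed

end
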